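(* Let $0<p<2$, $q>0$, $M>0$, $\alpha>0$ with $s=\alpha+\frac12-\frac1p>0$, and let $\Theta=B^\alpha_{p,q}(M)$ or $\Theta=L_p(\alpha,M)$. In the Gaussian sequence model $Y_i=\theta_i+n^{-1/2}z_i$ ($z_i$ i.i.d. $N(0,1)$), the minimax risk for estimating $Q(\theta)=\sum_i\theta_i^2$ satisfies, as $n\to\infty$: (i) if $\alpha>\frac{1}{2p}$, then $\inf_\delta\sup_{\theta\in\Theta}E_\theta(\delta-Q(\theta))^2\ge\frac{4M^2}{n}(1+o(1))$; (ii) if $\alpha\le\frac{1}{2p}$, then there is a constant $C>0$ such that $\inf_\delta\sup_{\theta\in\Theta}E_\theta(\delta-Q(\theta))^2\ge C\,n^{-(2-p/(1+2ps))}$. Here the infimum is over all estimators $\delta$ (measurable functions of the observations).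
   Context: The $L_p$ ball is $L_p(\alpha,M)=\{\theta:(\sum_{i\ge1}i^{ps}|\theta_i|^p)^{1/p}\le M\}$ with $s=\alpha+\frac12-\frac1p$. For Besov balls, sequences are doubly indexed $\theta_{j,k}$, $j=0,1,\dots$, $k=0,\dots,2^j-1$, identified with $\theta_i$ via $i=2^j+k$, and $B^\alpha_{p,q}(M)=\{\theta:(\sum_{j\ge0}(2^{js}(\sum_{k=0}^{2^j-1}|\theta_{j,k}|^p)^{1/p})^q)^{1/q}\le M\}$. *)

theory Defs
  imports "HOL-Probability.Probability"
begin

text \<open>Sequences are indexed from 0 in Isabelle; coordinate \<open>\<theta> i\<close> here stands for
  the paper's \<open>\<theta>_(i+1)\<close> (paper indices start at 1).\<close>

definition smooth_idx :: "real \<Rightarrow> real \<Rightarrow> real" where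
  "smooth_idx \<alpha> p = \<alpha> + 1/2 - 1/p"

definition Lp_ball :: "real \<Rightarrow> real \<Rightarrow> real \<Rightarrow> (nat \<Rightarrow> real) set" where
  "Lp_ball \<alpha> p M = {\<theta>.
     summable (\<lambda>i. (real (i+1)) powr (p * smooth_idx \<alpha> p) * \<bar>\<theta> i\<bar> powr p) \<and>
     (\<Sum>i. (real (i+1)) powr (p * smooth_idx \<alpha> p) * \<bar>\<theta> i\<bar> powr p) powr (1/p) \<le> M}"

text \<open>Double index (j,k), 0 <= k < 2^j, corresponds to paper index 2^j + k,
  i.e. Isabelle coordinate 2^j + k - 1.\<close>
definition wav :: "(nat \<Rightarrow> real) \<Rightarrow> nat \<Rightarrow> nat \<Rightarrow> real" where
  "wav \<theta> j k = \<theta> (2^j + k - 1)"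

definition besov_term :: "real \<Rightarrow> real \<Rightarrow> real \<Rightarrow> (nat \<Rightarrow> real) \<Rightarrow> nat \<Rightarrow> real" where
  "besov_term \<alpha> p q \<theta> j =
     (2 powr (real j * smooth_idx \<alpha> p) *
        (\<Sum>k<2^j. \<bar>wav \<theta> j k\<bar> powr p) powr (1/p)) powr q"

definition Besov_ball :: "real \<Rightarrow> real \<Rightarrow> real \<Rightarrow> real \<Rightarrow> (nat \<Rightarrow> real) set" where
  "Besov_ball \<alpha> p q M = {\<theta>.
     summable (besov_term \<alpha> p q \<theta>) \<and> (\<Sum>j. besov_term \<alpha> p q \<theta> j) powr (1/q) \<le> M}"

definition Qfun :: "(nat \<Rightarrow> real) \<Rightarrow> real" where
  "Qfun \<theta> = (\<Sum>i. (\<theta> i)^2)"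

definition gauss_seq_model :: "nat \<Rightarrow> (nat \<Rightarrow> real) \<Rightarrow> (nat \<Rightarrow> real) measure" where
  "gauss_seq_model n \<theta> =
     PiM UNIV (\<lambda>i. density lborel (normal_density (\<theta> i) (1 / sqrt (real n))))"

definition estimators :: "((nat \<Rightarrow> real) \<Rightarrow> real) set" where
  "estimators = borel_measurable (PiM UNIV (\<lambda>_::nat. (borel :: real measure)))"

definition risk :: "nat \<Rightarrow> ((nat \<Rightarrow> real) \<Rightarrow> real) \<Rightarrow> (nat \<Rightarrow> real) \<Rightarrow> ennreal" where
  "risk n \<delta> \<theta> = (\<integral>\<^sup>+ y. ennreal ((\<delta> y - Qfun \<theta>)^2) \<partial>gauss_seq_model n \<theta>)"

definition minimax_risk :: "nat \<Rightarrow> (nat \<Rightarrow> real) set \<Rightarrow> ennreal" where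
  "minimax_risk n \<Theta> = (INF \<delta>\<in>estimators. SUP \<theta>\<in>\<Theta>. risk n \<delta> \<theta>)"

end

theory Submission
  imports Defs
begin

text \<open>
  Both bounds restrict the supremum to a small subfamily of the ball and compare with the
  measure at \<open>\<theta> = 0\<close>, with respect to which every finitely supported \<open>\<theta>\<close> has an explicit
  likelihood ratio.

  For (i) only the first coordinate \<open>t \<in> [a, M]\<close> varies, so that \<open>Q = t\<^sup>2\<close>, and van Trees'
  inequality for the prior proportional to \<open>((t - a) (M - t))\<^sup>2\<close> gives \<open>4 a\<^sup>2 / n\<close> up to a factor
  \<open>1 + O(1/n)\<close>; then \<open>a\<close> is taken close to \<open>M\<close>.

  For (ii) let \<open>k = 2^h\<close>, take the \<open>k\<^sup>2\<close> coordinates of wavelet level \<open>2 h\<close>, cut them into \<open>k\<close>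
  blocks of length \<open>k\<close>, and put one spike of height \<open>a\<close>, of order \<open>n powr (- 1/2)\<close>, at a uniformly
  random place of each block. This mixture has bounded chi-square distance from \<open>\<theta> = 0\<close>, although
  the values of \<open>Q\<close> differ by \<open>k a\<^sup>2\<close>, so the risk is at least of order \<open>k\<^sup>2 / n\<^sup>2\<close>. The ball allows
  \<open>k\<^sup>2\<close> of order \<open>n powr (p / (1 + 2 p s))\<close>.
\<close>

subsection \<open>Likelihood ratios in the sequence model\<close>

text \<open>Only the coordinates in \<open>J\<close> enter, and the projection of the infinite
  product to \<open>J\<close> is the finite product, where Fubini applies.\<close>

lemma nn_integral_PiM_prod:
  fixes M :: "'i \<Rightarrow> 'a measure"
  assumes M: "\<And>i. prob_space (M i)" and J: "finite J"
    and f: "\<And>i. i \<in> J \<Longrightarrow> f i \<in> borel_measurable (M i)"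
  shows "(\<integral>\<^sup>+ x. (\<Prod>i\<in>J. f i (x i)) \<partial>PiM UNIV M) = (\<Prod>i\<in>J. \<integral>\<^sup>+ x. f i x \<partial>M i)"
proof -
  interpret product_prob_space M UNIV
    by (rule product_prob_spaceI) (rule M)
  note f[measurable]
  have "(\<Prod>i\<in>J. \<integral>\<^sup>+ x. f i x \<partial>M i) = (\<integral>\<^sup>+ x. (\<Prod>i\<in>J. f i (x i)) \<partial>PiM J M)"
    by (subst product_nn_integral_prod[OF J]) (auto intro: f)
  also have "\<dots> = (\<integral>\<^sup>+ x. (\<Prod>i\<in>J. f i (x i)) \<partial>distr (PiM UNIV M) (PiM J M) (\<lambda>x. restrict x J))"
    by (simp add: distr_PiM_restrict_finite J)
  also have "\<dots> = (\<integral>\<^sup>+ x. (\<Prod>i\<in>J. f i (restrict x J i)) \<partial>PiM UNIV M)"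
    by (subst nn_integral_distr) (auto intro!: measurable_restrict_subset borel_measurable_prod_ennreal
        measurable_compose[OF measurable_component_singleton] f)
  also have "\<dots> = (\<integral>\<^sup>+ x. (\<Prod>i\<in>J. f i (x i)) \<partial>PiM UNIV M)"
    by (intro nn_integral_cong prod.cong) auto
  finally show ?thesis ..
qed

text \<open>For \<open>\<theta>\<close> supported in \<open>I\<close> this is the density of the
  model at \<open>\<theta>\<close> with respect to the model at 0: each factor is the ratio of the
  normal densities with means \<open>\<theta> i\<close> and 0 and variance 1/n.\<close>

definition lik :: "nat \<Rightarrow> nat set \<Rightarrow> (nat \<Rightarrow> real) \<Rightarrow> (nat \<Rightarrow> real) \<Rightarrow> real" where
  "lik n I \<theta> y = (\<Prod>i\<in>I. exp (real n * \<theta> i * y i - real n * (\<theta> i)\<^sup>2 / 2))"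

lemma sets_gauss_seq_model [measurable_cong]:
  "sets (gauss_seq_model n \<theta>) = sets (PiM UNIV (\<lambda>_::nat. borel :: real measure))"
  unfolding gauss_seq_model_def by (intro sets_PiM_cong) auto

lemma lik_measurable [measurable]:
  "lik n I \<theta> \<in> borel_measurable (PiM UNIV (\<lambda>_::nat. borel :: real measure))"
  unfolding lik_def by measurable

lemma prob_space_normal: "n > 0 \<Longrightarrow>
    prob_space (density lborel (normal_density \<mu> (1 / sqrt (real n))))"
  by (intro prob_space_normal_density) simp

lemma prob_space_gauss_seq_model: "n > 0 \<Longrightarrow> prob_space (gauss_seq_model n \<theta>)"
  unfolding gauss_seq_model_def by (intro prob_space_PiM prob_space_normal)

lemma normal_density_shift:
  assumes "n > 0"
  shows "normal_density \<mu> (1 / sqrt (real n)) x =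
    normal_density 0 (1 / sqrt (real n)) x * exp (real n * \<mu> * x - real n * \<mu>\<^sup>2 / 2)"
proof -
  have "- (x - \<mu>)\<^sup>2 / (2 * (1 / sqrt (real n))\<^sup>2) =
      - (x - 0)\<^sup>2 / (2 * (1 / sqrt (real n))\<^sup>2) + (real n * \<mu> * x - real n * \<mu>\<^sup>2 / 2)"
    using assms by (simp add: power_divide field_simps power2_eq_square)
  then show ?thesis unfolding normal_density_def by (simp only: exp_add mult.assoc)
qed

text \<open>A finite measure on an infinite product is determined by its values on cylinder sets. On
  a cylinder with base in \<open>J\<close> both sides factor into integrals over the single
  coordinates of \<open>I \<union> J\<close>.\<close>

lemma gauss_seq_model_density:
  assumes n: "n > 0" and I: "finite I" and \<theta>: "\<And>i. i \<notin> I \<Longrightarrow> \<theta> i = 0"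
  shows "gauss_seq_model n \<theta> = density (gauss_seq_model n (\<lambda>_. 0)) (\<lambda>y. ennreal (lik n I \<theta> y))"
proof -
  let ?N = "\<lambda>\<mu>. density lborel (normal_density \<mu> (1 / sqrt (real n)))"
  let ?L = "\<lambda>i x. ennreal (exp (real n * \<theta> i * x - real n * (\<theta> i)\<^sup>2 / 2))"
  have N: "prob_space (?N \<mu>)" for \<mu> by (rule prob_space_normal[OF n])
  have PiM_borel [measurable_cong]: "sets (Pi\<^sub>M UNIV (\<lambda>i::nat. ?N 0)) = sets (PiM UNIV (\<lambda>_. borel))"
    by (intro sets_PiM_cong) auto
  show ?thesis
    unfolding gauss_seq_model_def
  proof (rule measure_eqI_PiM_infinite)
    show "finite_measure (Pi\<^sub>M UNIV (\<lambda>i. ?N (\<theta> i)))"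
      using prob_space_gauss_seq_model[OF n] unfolding gauss_seq_model_def
      by (auto simp: prob_space_def)
    show "sets (density (Pi\<^sub>M UNIV (\<lambda>i. ?N 0)) (\<lambda>y. ennreal (lik n I \<theta> y))) = sets (Pi\<^sub>M UNIV (\<lambda>i. ?N (\<theta> i)))"
      by (simp, intro sets_PiM_cong) auto
    fix A :: "nat \<Rightarrow> real set" and J
    assume J: "finite J" and A: "\<And>i. i \<in> J \<Longrightarrow> A i \<in> sets (?N (\<theta> i))"
    have A'[measurable]: "i \<in> J \<Longrightarrow> A i \<in> sets borel" for i using A[of i] by simp
    let ?X = "prod_emb UNIV (\<lambda>i. ?N (\<theta> i)) J (Pi\<^sub>E J A)"
    have X: "y \<in> ?X \<longleftrightarrow> (\<forall>i\<in>J. y i \<in> A i)" for y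
      by (auto simp: prod_emb_def space_PiM PiE_def Pi_def)
    \<comment> \<open>The default 1 for an absent likelihood factor or indicator lets both products
      run over \<open>I \<union> J\<close>.\<close>
    let ?f = "\<lambda>i x. (if i \<in> I then ?L i x else 1) * (if i \<in> J then indicator (A i) x else 1)"
    have f_meas: "?f i \<in> borel_measurable borel" for i
    proof (cases "i \<in> J")
      case True
      then have [measurable]: "A i \<in> sets borel" by (rule A')
      show ?thesis by measurable
    next
      case False
      then show ?thesis by simp
    qed
    have meas: "?X \<in> sets (Pi\<^sub>M UNIV (\<lambda>i. ?N 0))"
    proof -
      have "?X \<in> sets (Pi\<^sub>M UNIV (\<lambda>i. ?N (\<theta> i)))" using J A by (intro sets_PiM_I) auto
      also have "\<dots> = sets (Pi\<^sub>M UNIV (\<lambda>i. ?N 0))" by (intro sets_PiM_cong) auto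
      finally show ?thesis .
    qed
    then have [measurable]: "?X \<in> sets (PiM UNIV (\<lambda>_. borel))" using PiM_borel by simp
    have "emeasure (density (Pi\<^sub>M UNIV (\<lambda>i. ?N 0)) (\<lambda>y. ennreal (lik n I \<theta> y))) ?X
        = (\<integral>\<^sup>+ y. ennreal (lik n I \<theta> y) * indicator ?X y \<partial>Pi\<^sub>M UNIV (\<lambda>i. ?N 0))"
      using meas by (intro emeasure_density) measurable
    also have "\<dots> = (\<integral>\<^sup>+ y. (\<Prod>i\<in>I \<union> J. ?f i (y i)) \<partial>Pi\<^sub>M UNIV (\<lambda>i. ?N 0))"
    proof (intro nn_integral_cong)
      fix y :: "nat \<Rightarrow> real"
      have "indicator ?X y = (\<Prod>i\<in>J. indicator (A i) (y i) :: ennreal)"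
        using X[of y] J by (auto simp: indicator_def prod_zero_iff)
      also have "\<dots> = (\<Prod>i\<in>I \<union> J. (if i \<in> J then indicator (A i) (y i) else 1))"
        using I J by (intro prod.mono_neutral_cong_left) auto
      finally have 1: "indicator ?X y = (\<Prod>i\<in>I \<union> J. (if i \<in> J then indicator (A i) (y i) else 1) :: ennreal)" .
      have "ennreal (lik n I \<theta> y) = (\<Prod>i\<in>I. ?L i (y i))"
        unfolding lik_def by (simp add: prod_ennreal)
      also have "\<dots> = (\<Prod>i\<in>I \<union> J. (if i \<in> I then ?L i (y i) else 1))"
        using I J by (intro prod.mono_neutral_cong_left) auto
      finally show "ennreal (lik n I \<theta> y) * indicator ?X y = (\<Prod>i\<in>I \<union> J. ?f i (y i))"
        by (simp only: 1 prod.distrib)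
    qed
    also have "\<dots> = (\<Prod>i\<in>I \<union> J. \<integral>\<^sup>+ x. ?f i x \<partial>?N 0)"
    proof (intro nn_integral_PiM_prod N)
      show "?f i \<in> borel_measurable (?N 0)" for i using f_meas by simp
    qed (use I J in auto)
    also have "\<dots> = (\<Prod>i\<in>I \<union> J. if i \<in> J then emeasure (?N (\<theta> i)) (A i) else 1)"
    proof (intro prod.cong refl)
      fix i
      \<comment> \<open>For \<open>i \<notin> I\<close> the mean \<open>\<theta> i\<close> is 0, so
        the absent likelihood factor is indeed 1.\<close>
      have shift: "ennreal (normal_density (\<theta> i) (1 / sqrt (real n)) x) =
          ennreal (normal_density 0 (1 / sqrt (real n)) x) * (if i \<in> I then ?L i x else 1)" for x
        using \<theta>[of i] by (subst normal_density_shift[OF n]) (auto simp: ennreal_mult)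
      let ?B = "if i \<in> J then A i else UNIV"
      have "(\<integral>\<^sup>+ x. ?f i x \<partial>?N 0) =
          (\<integral>\<^sup>+ x. ennreal (normal_density 0 (1 / sqrt (real n)) x) * ?f i x \<partial>lborel)"
        using f_meas[of i] by (subst nn_integral_density) auto
      also have "\<dots> = (\<integral>\<^sup>+ x. ennreal (normal_density (\<theta> i) (1 / sqrt (real n)) x) * indicator ?B x \<partial>lborel)"
        by (intro nn_integral_cong) (simp add: shift mult.assoc)
      also have "\<dots> = emeasure (?N (\<theta> i)) ?B"
        by (subst emeasure_density) auto
      also have "\<dots> = (if i \<in> J then emeasure (?N (\<theta> i)) (A i) else 1)"
        using prob_space.emeasure_space_1[OF N[of "\<theta> i"]] by simp
      finally show "(\<integral>\<^sup>+ x. ?f i x \<partial>?N 0) = (if i \<in> J then emeasure (?N (\<theta> i)) (A i) else 1)" .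
    qed
    also have "\<dots> = (\<Prod>i\<in>J. emeasure (?N (\<theta> i)) (A i))"
      using I J by (intro prod.mono_neutral_cong_right) auto
    also have "\<dots> = emeasure (Pi\<^sub>M UNIV (\<lambda>i. ?N (\<theta> i))) ?X"
      using J A by (intro emeasure_PiM_emb[symmetric] N) auto
    finally show "emeasure (Pi\<^sub>M UNIV (\<lambda>i. ?N (\<theta> i))) ?X =
       emeasure (density (Pi\<^sub>M UNIV (\<lambda>i. ?N 0)) (\<lambda>y. ennreal (lik n I \<theta> y))) ?X" ..
  qed (auto)
qed

lemma risk_eq:
  assumes "n > 0" "finite I" "\<And>i. i \<notin> I \<Longrightarrow> \<theta> i = 0" "\<delta> \<in> estimators"
  shows "risk n \<delta> \<theta> = (\<integral>\<^sup>+ y. ennreal (lik n I \<theta> y * (\<delta> y - Qfun \<theta>)\<^sup>2) \<partial>gauss_seq_model n (\<lambda>_. 0))"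
proof -
  note assms(4)[unfolded estimators_def, measurable]
  show ?thesis
    unfolding risk_def
    by (subst gauss_seq_model_density[OF assms(1-3)], simp, subst nn_integral_density)
       (auto simp: ennreal_mult lik_def prod_nonneg)
qed

lemma nn_integral_lik:
  assumes "n > 0" "finite I" "\<And>i. i \<notin> I \<Longrightarrow> \<theta> i = 0"
  shows "(\<integral>\<^sup>+ y. ennreal (lik n I \<theta> y) \<partial>gauss_seq_model n (\<lambda>_. 0)) = 1"
proof -
  interpret prob_space "gauss_seq_model n \<theta>" by (rule prob_space_gauss_seq_model) fact
  have "1 = emeasure (gauss_seq_model n \<theta>) (space (gauss_seq_model n \<theta>))"
    by (simp add: emeasure_space_1)
  also have "\<dots> = (\<integral>\<^sup>+ y. ennreal (lik n I \<theta> y) \<partial>gauss_seq_model n (\<lambda>_. 0))"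
    by (subst (1 2) gauss_seq_model_density[OF assms])
       (auto simp: emeasure_density intro!: nn_integral_cong)
  finally show ?thesis ..
qed

text \<open>Since x^2 + y^2 = (x + y)^2 - 2 x y in the exponents, a product of two likelihood ratios
  is a constant times a third one. This makes second moments of mixtures explicit.\<close>

lemma lik_mult:
  "lik n I \<theta> y * lik n I \<theta>' y = lik n I (\<lambda>i. \<theta> i + \<theta>' i) y * exp (real n * (\<Sum>i\<in>I. \<theta> i * \<theta>' i))"
proof (cases "finite I")
  case True
  then show ?thesis
    by (simp add: lik_def sum_distrib_left exp_sum flip: prod.distrib exp_add)
       (auto intro!: prod.cong simp: power2_eq_square field_simps)
qed (simp add: lik_def)

subsection \<open>Membership in the balls\<close>

text \<open>One inequality serves both balls. With only level \<open>J\<close> nonzero, the outer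
  Besov sum has a single term, so the power \<open>q\<close> cancels; and as the smoothness index is
  nonnegative, the Besov weight, a power of 2^J, is at most the same power of 2^J + k, the weight in
  the Lp ball.\<close>

lemma single_level_mem_balls:
  fixes \<theta> :: "nat \<Rightarrow> real" and J :: nat
  assumes "0 < p" "0 < q" "0 < M"
    and \<theta>: "\<And>i. i + 1 < 2 ^ J \<or> 2 ^ (J + 1) \<le> i + 1 \<Longrightarrow> \<theta> i = 0"
    and s: "smooth_idx \<alpha> p \<ge> 0"
    and le: "(\<Sum>k<2^J. real (2 ^ J + k) powr (p * smooth_idx \<alpha> p) * \<bar>\<theta> (2 ^ J + k - 1)\<bar> powr p) \<le> M powr p"
  shows "\<theta> \<in> Besov_ball \<alpha> p q M" "\<theta> \<in> Lp_ball \<alpha> p M"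
proof -
  let ?s = "smooth_idx \<alpha> p"
  define S where "S = (\<Sum>k<2^J. real (2 ^ J + k) powr (p * ?s) * \<bar>\<theta> (2 ^ J + k - 1)\<bar> powr p)"
  have S0: "0 \<le> S" unfolding S_def by (intro sum_nonneg) auto
  have SM: "S powr (1/p) \<le> M"
  proof -
    have "S powr (1/p) \<le> (M powr p) powr (1/p)"
      using le S0 assms by (intro powr_mono2) (auto simp: S_def)
    then show ?thesis using assms by (simp add: powr_powr)
  qed
  let ?f = "\<lambda>i. real (i+1) powr (p * ?s) * \<bar>\<theta> i\<bar> powr p"
  have "?f sums (\<Sum>i\<in>(\<lambda>k. 2^J + k - 1) ` {..<2^J}. ?f i)"
  proof (rule sums_finite)
    fix i :: nat assume i: "i \<notin> (\<lambda>k. 2^J + k - 1) ` {..<2^J}"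
    have "i + 1 < 2 ^ J \<or> 2 ^ (J + 1) \<le> i + 1"
    proof (rule ccontr)
      assume "\<not> ?thesis"
      then have "i = 2^J + (i + 1 - 2^J) - 1" "i + 1 - 2^J < 2^J" by auto
      with i show False by blast
    qed
    then show "?f i = 0" using \<theta> assms by simp
  qed auto
  also have "(\<Sum>i\<in>(\<lambda>k. 2^J + k - 1) ` {..<2^J}. ?f i) = S"
    unfolding S_def by (subst sum.reindex) (auto simp: inj_on_def intro!: sum.cong)
  finally have "?f sums S" .
  then show "\<theta> \<in> Lp_ball \<alpha> p M"
    using SM by (auto simp: Lp_ball_def sums_iff)
  have "besov_term \<alpha> p q \<theta> j = 0" if "j \<noteq> J" for j
  proof -
    have "wav \<theta> j k = 0" if k: "k < 2 ^ j" for k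
    proof -
      \<comment> \<open>Distinct levels occupy disjoint dyadic ranges.\<close>
      have "(2::nat) ^ (j+1) \<le> 2 ^ J \<or> (2::nat) ^ (J+1) \<le> 2 ^ j"
        using \<open>j \<noteq> J\<close> by (cases "j < J") (auto simp del: power_Suc intro!: power_increasing)
      then show ?thesis unfolding wav_def
        by (intro \<theta>) (use k in auto)
    qed
    then show ?thesis unfolding besov_term_def using assms by simp
  qed
  then have "besov_term \<alpha> p q \<theta> sums (\<Sum>j\<in>{J}. besov_term \<alpha> p q \<theta> j)"
    by (intro sums_finite) auto
  then have sums: "besov_term \<alpha> p q \<theta> sums besov_term \<alpha> p q \<theta> J" by simp
  define B where "B = (\<Sum>k<2^J. \<bar>wav \<theta> J k\<bar> powr p)"
  have B0: "B \<ge> 0" unfolding B_def by (intro sum_nonneg) auto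
  have "2 powr (p * (real J * ?s)) * B \<le> S"
    unfolding B_def S_def sum_distrib_left
  proof (intro sum_mono)
    fix k :: nat
    have "2 powr (p * (real J * ?s)) = real (2 ^ J) powr (p * ?s)"
      by (simp add: powr_powr powr_realpow[symmetric] mult_ac)
    also have "\<dots> \<le> real (2 ^ J + k) powr (p * ?s)"
      using assms by (intro powr_mono2) auto
    finally show "2 powr (p * (real J * ?s)) * \<bar>wav \<theta> J k\<bar> powr p
        \<le> real (2 ^ J + k) powr (p * ?s) * \<bar>\<theta> (2 ^ J + k - 1)\<bar> powr p"
      unfolding wav_def by (intro mult_right_mono) auto
  qed
  then have "(2 powr (p * (real J * ?s)) * B) powr (1/p) \<le> S powr (1/p)"
    using assms B0 by (intro powr_mono2) auto
  also have "(2 powr (p * (real J * ?s)) * B) powr (1/p) = 2 powr (real J * ?s) * B powr (1/p)"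
    using assms B0 by (simp add: powr_mult powr_powr)
  finally have "2 powr (real J * ?s) * B powr (1/p) \<le> M" using SM by simp
  moreover have "besov_term \<alpha> p q \<theta> J powr (1/q) = 2 powr (real J * ?s) * B powr (1/p)"
    unfolding besov_term_def B_def[symmetric] using assms by (simp add: powr_powr)
  ultimately show "\<theta> \<in> Besov_ball \<alpha> p q M"
    using sums by (auto simp: Besov_ball_def sums_iff)
qed

lemma zero_mem_balls:
  assumes "0 < p" "0 < q" "0 < M" "smooth_idx \<alpha> p \<ge> 0"
  shows "(\<lambda>_. 0) \<in> Besov_ball \<alpha> p q M" "(\<lambda>_. 0) \<in> Lp_ball \<alpha> p M"
  using single_level_mem_balls[of p q M 0 "\<lambda>_. 0" \<alpha>] assms by auto

text \<open>Level 0 consists of coordinate 0 alone and has weight 1, so both norms equal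
  \<bar>t\<bar>.\<close>

lemma first_coordinate_mem_balls:
  assumes "0 < p" "0 < q" "0 < M" "smooth_idx \<alpha> p \<ge> 0" "\<bar>t\<bar> \<le> M"
  shows "(\<lambda>i. if i = 0 then t else 0) \<in> Besov_ball \<alpha> p q M"
    "(\<lambda>i. if i = 0 then t else 0) \<in> Lp_ball \<alpha> p M"
  using single_level_mem_balls[of p q M 0 "\<lambda>i. if i = 0 then t else 0" \<alpha>] assms
    powr_mono2[of p "\<bar>t\<bar>" M] by auto

section \<open>Finitely supported parameters and reduction to finite risks\<close>

lemma Qfun_finite:
  assumes "finite I" "\<And>i. i \<notin> I \<Longrightarrow> \<theta> i = 0"
  shows "Qfun \<theta> = (\<Sum>i\<in>I. (\<theta> i)\<^sup>2)"
  unfolding Qfun_def using assms by (intro suminf_finite) auto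

text \<open>If the supremum of the risks is infinite there is nothing to prove; otherwise it is a
  real \<open>R\<close>, and the bound becomes a matter of real arithmetic.\<close>

lemma minimax_lower_bound:
  assumes "\<And>\<delta> R. \<delta> \<in> estimators \<Longrightarrow> (\<And>\<theta>. \<theta> \<in> \<Theta> \<Longrightarrow> risk n \<delta> \<theta> \<le> ennreal R) \<Longrightarrow> 0 \<le> R \<Longrightarrow> r \<le> R"
  shows "ennreal r \<le> minimax_risk n \<Theta>"
  unfolding minimax_risk_def
proof (rule INF_greatest)
  fix \<delta> assume \<delta>: "\<delta> \<in> estimators"
  show "ennreal r \<le> (SUP \<theta>\<in>\<Theta>. risk n \<delta> \<theta>)"
  proof (cases "SUP \<theta>\<in>\<Theta>. risk n \<delta> \<theta>")
    case (real R)
    then have "risk n \<delta> \<theta> \<le> ennreal R" if "\<theta> \<in> \<Theta>" for \<theta>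
      using that by (metis SUP_upper)
    with assms[OF \<delta>] real show ?thesis by (simp add: ennreal_leI)
  qed (metis top_greatest)
qed

subsection \<open>A van Trees inequality\<close>

text \<open>After expanding the square, the cross term vanishes with the first central moment. This
  evaluates the second moment of a score that is affine in the observation.\<close>

lemma nn_integral_normal_affine_square:
  assumes \<sigma>: "0 < \<sigma>"
  shows "(\<integral>\<^sup>+ x. ennreal ((u + v * (x - \<mu>))\<^sup>2) \<partial>density lborel (normal_density \<mu> \<sigma>)) = ennreal (u\<^sup>2 + v\<^sup>2 * \<sigma>\<^sup>2)"
proof -
  have m0: "has_bochner_integral lborel (\<lambda>x. normal_density \<mu> \<sigma> x) 1"
    using normal_moment_even[OF \<sigma>, of \<mu> 0] by simp
  have m1: "has_bochner_integral lborel (\<lambda>x. normal_density \<mu> \<sigma> x * (x - \<mu>)) 0"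
    using normal_moment_odd[OF \<sigma>, of \<mu> 0] by simp
  have m2: "has_bochner_integral lborel (\<lambda>x. normal_density \<mu> \<sigma> x * (x - \<mu>)\<^sup>2) (\<sigma>\<^sup>2)"
    using normal_moment_even[OF \<sigma>, of \<mu> 1] by simp
  have "has_bochner_integral lborel (\<lambda>x. u\<^sup>2 * normal_density \<mu> \<sigma> x +
      2 * u * v * (normal_density \<mu> \<sigma> x * (x - \<mu>)) + v\<^sup>2 * (normal_density \<mu> \<sigma> x * (x - \<mu>)\<^sup>2))
      (u\<^sup>2 * 1 + 2 * u * v * 0 + v\<^sup>2 * \<sigma>\<^sup>2)"
    by (intro has_bochner_integral_add has_bochner_integral_mult_right m0 m1 m2)
  then have "has_bochner_integral lborel (\<lambda>x. normal_density \<mu> \<sigma> x * (u + v * (x - \<mu>))\<^sup>2) (u\<^sup>2 + v\<^sup>2 * \<sigma>\<^sup>2)"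
    by (rule has_bochner_integral_cong[THEN iffD1, rotated 3]) (auto simp: power2_eq_square algebra_simps)
  then have "(\<integral>\<^sup>+ x. ennreal (normal_density \<mu> \<sigma> x * (u + v * (x - \<mu>))\<^sup>2) \<partial>lborel) = ennreal (u\<^sup>2 + v\<^sup>2 * \<sigma>\<^sup>2)"
    by (subst nn_integral_eq_integral) (auto simp: has_bochner_integral_iff)
  then show ?thesis
    by (subst nn_integral_density) (auto simp: ennreal_mult)
qed

lemma nn_integral_gauss_coordinate:
  assumes n: "n > 0" and [measurable]: "h \<in> borel_measurable borel"
  shows "(\<integral>\<^sup>+ y. h (y i) \<partial>gauss_seq_model n \<theta>) =
    (\<integral>\<^sup>+ x. h x \<partial>density lborel (normal_density (\<theta> i) (1 / sqrt (real n))))"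
proof -
  let ?N = "\<lambda>i. density lborel (normal_density (\<theta> i) (1 / sqrt (real n)))"
  have "(\<integral>\<^sup>+ x. h x \<partial>?N i) = (\<integral>\<^sup>+ x. h x \<partial>distr (gauss_seq_model n \<theta>) (?N i) (\<lambda>y. y i))"
    unfolding gauss_seq_model_def by (subst distr_PiM_component) (auto intro: prob_space_normal n)
  also have "\<dots> = (\<integral>\<^sup>+ y. h (y i) \<partial>gauss_seq_model n \<theta>)"
    by (subst nn_integral_distr) (auto simp: gauss_seq_model_def)
  finally show ?thesis ..
qed

lemma nn_integral_Icc_continuous:
  fixes f :: "real \<Rightarrow> real"
  assumes "continuous_on {a..b} f" "\<And>t. t \<in> {a..b} \<Longrightarrow> 0 \<le> f t"
  shows "(\<integral>\<^sup>+ t. ennreal (f t) * indicator {a..b} t \<partial>lborel) = ennreal (integral {a..b} f)"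
proof -
  have si: "set_integrable lborel {a..b} f" by (rule borel_integrable_atLeastAtMost'[OF assms(1)])
  have "(\<integral>\<^sup>+ t. ennreal (f t) * indicator {a..b} t \<partial>lborel) = (\<integral>\<^sup>+ t. ennreal (indicator {a..b} t *\<^sub>R f t) \<partial>lborel)"
    by (intro nn_integral_cong) (auto simp: indicator_def)
  also have "\<dots> = ennreal (\<integral>t. indicator {a..b} t *\<^sub>R f t \<partial>lborel)"
    using si assms(2) unfolding set_integrable_def
    by (intro nn_integral_eq_integral) (auto simp: indicator_def)
  also have "(\<integral>t. indicator {a..b} t *\<^sub>R f t \<partial>lborel) = integral {a..b} f"
    using set_borel_integral_eq_integral(2)[OF si] unfolding set_lebesgue_integral_def .
  finally show ?thesis .
qed

text \<open>The integral of \<open>h\<close> is \<open>H b - H a\<close>, which is 0, so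
  \<open>h\<close> drops out after integration. As \<open>h\<close> may change sign, the comparison
  goes through real-valued integrals.\<close>

lemma nn_integral_Icc_mono_derivative:
  fixes f g H h :: "real \<Rightarrow> real"
  assumes ab: "a \<le> b"
    and cont: "continuous_on {a..b} f" "continuous_on {a..b} g"
    and H: "\<And>t. (H has_real_derivative h t) (at t)" "H a = H b"
    and le: "\<And>t. t \<in> {a..b} \<Longrightarrow> g t + h t \<le> f t"
    and nonneg: "\<And>t. t \<in> {a..b} \<Longrightarrow> 0 \<le> g t" "\<And>t. t \<in> {a..b} \<Longrightarrow> 0 \<le> f t"
  shows "(\<integral>\<^sup>+ t. ennreal (g t) * indicator {a..b} t \<partial>lborel) \<le> (\<integral>\<^sup>+ t. ennreal (f t) * indicator {a..b} t \<partial>lborel)"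
proof -
  have "(h has_integral H b - H a) {a..b}"
  proof (rule fundamental_theorem_of_calculus[OF ab])
    show "(H has_vector_derivative h t) (at t within {a..b})" for t
      unfolding has_real_derivative_iff_has_vector_derivative[symmetric]
      by (rule has_field_derivative_at_within[OF H(1)])
  qed
  then have h: "(h has_integral 0) {a..b}" using H(2) by simp
  have "((\<lambda>t. g t + h t) has_integral integral {a..b} g + 0) {a..b}"
    by (intro has_integral_add h integrable_integral integrable_continuous_real[OF cont(2)])
  then have "integral {a..b} g + 0 \<le> integral {a..b} f"
    by (rule has_integral_le[OF _ integrable_integral[OF integrable_continuous_real[OF cont(1)]] le])
  then show ?thesis
    using nn_integral_Icc_continuous[OF cont(1) nonneg(2)] nn_integral_Icc_continuous[OF cont(2) nonneg(1)]
    by (simp add: ennreal_leI)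
qed

text \<open>The Cauchy-Schwarz step of van Trees' inequality in the form \<open>A\<^sup>2 + c\<^sup>2 B\<^sup>2 \<ge> 2 c A B\<close>. The cross
  term differs from the left-hand side by the derivative of \<open>2 c (d - t\<^sup>2) (w t)\<^sup>2 L t\<close>, which vanishes
  at both endpoints.\<close>

lemma van_trees_pointwise:
  fixes a b c d x :: real and n :: nat
  assumes ab: "0 < a" "a \<le> b" "0 \<le> c"
  defines "w \<equiv> \<lambda>t. (t - a) * (b - t)" and "L \<equiv> \<lambda>t. exp (real n * t * x - real n * t\<^sup>2 / 2)"
  shows "(\<integral>\<^sup>+ t. ennreal (4 * c * t * (w t)\<^sup>2 * L t) * indicator {a..b} t \<partial>lborel) \<le>
    (\<integral>\<^sup>+ t. ennreal ((w t)\<^sup>2 * (L t * (d - t\<^sup>2)\<^sup>2) +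
        c\<^sup>2 * (L t * (2 * (a + b - 2 * t) + w t * real n * (x - t))\<^sup>2)) * indicator {a..b} t \<partial>lborel)"
proof (rule nn_integral_Icc_mono_derivative)
  \<comment> \<open>\<open>S t * w t * L t\<close> is the derivative of
    \<open>(w t)\<^sup>2 * L t\<close>, because \<open>w\<close> has derivative
    \<open>a + b - 2 * t\<close> and \<open>L\<close> has logarithmic derivative
    \<open>real n * (x - t)\<close>.\<close>
  define S where "S t = 2 * (a + b - 2 * t) + w t * real n * (x - t)" for t
  let ?H = "\<lambda>t. 2 * c * ((d - t\<^sup>2) * (w t)\<^sup>2 * L t)"
  let ?h = "\<lambda>t. 2 * c * ((d - t\<^sup>2) * S t * w t * L t - 2 * t * (w t)\<^sup>2 * L t)"
  show "(?H has_real_derivative ?h t) (at t)" for t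
    unfolding w_def L_def S_def
    by (rule derivative_eq_intros refl | simp)+ (simp add: power2_eq_square algebra_simps)
  show "?H a = ?H b" by (simp add: w_def)
  show "4 * c * t * (w t)\<^sup>2 * L t + ?h t \<le> (w t)\<^sup>2 * (L t * (d - t\<^sup>2)\<^sup>2) +
        c\<^sup>2 * (L t * (2 * (a + b - 2 * t) + w t * real n * (x - t))\<^sup>2)" for t
  proof -
    \<comment> \<open>Here A is \<open>(d - t\<^sup>2) * w t\<close> and B is \<open>S t\<close>,
      with weight \<open>L t\<close>.\<close>
    have "0 \<le> L t * ((d - t\<^sup>2) * w t - c * S t)\<^sup>2" by (simp add: L_def)
    then show ?thesis unfolding S_def[symmetric] by (simp add: power2_eq_square algebra_simps)
  qed
qed (use ab in \<open>auto simp: w_def L_def intro!: continuous_intros mult_nonneg_nonneg add_nonneg_nonneg\<close>)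

text \<open>Averaging the pointwise inequality over the observation at \<theta> = 0 gives
  \<open>4 * c * a * W \<le> W * R + c\<^sup>2 * (4 * V + real n * W)\<close>. After division by
  \<open>W\<close>, \<open>real n\<close> is the Fisher information of the observation and
  \<open>4 * V / W\<close> that of the prior.\<close>

lemma van_trees_square:
  fixes a b R :: real and n :: nat
  assumes n: "n > 0" and ab: "0 < a" "a < b" and \<delta>: "\<delta> \<in> estimators" and R: "0 \<le> R"
    and risk: "\<And>t. a \<le> t \<Longrightarrow> t \<le> b \<Longrightarrow> risk n \<delta> (\<lambda>i. if i = 0 then t else 0) \<le> ennreal R"
  defines "W \<equiv> integral {a..b} (\<lambda>t. ((t - a) * (b - t))\<^sup>2)" and "V \<equiv> integral {a..b} (\<lambda>t. (a + b - 2 * t)\<^sup>2)"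
  shows "4 * a\<^sup>2 / real n * (1 - 4 * V / (W * real n)) \<le> R" "0 < W" "0 \<le> V"
proof -
  define w where "w t = (t - a) * (b - t)" for t :: real
  define L where "L t x = exp (real n * t * x - real n * t\<^sup>2 / 2)" for t x :: real
  let ?\<theta> = "\<lambda>t i::nat. if i = 0 then t else (0::real)"
  let ?P = "gauss_seq_model n (\<lambda>_. 0)"
  note \<delta>[unfolded estimators_def, measurable]
  interpret P: prob_space ?P by (rule prob_space_gauss_seq_model[OF n])
  interpret PP: pair_sigma_finite lborel ?P ..
  have lik: "lik n {0} (?\<theta> t) y = L t (y 0)" for t y by (simp add: lik_def L_def)
  have Q: "Qfun (?\<theta> t) = t\<^sup>2" for t by (subst Qfun_finite[of "{0}"]) auto
  \<comment> \<open>this \<open>c\<close> maximises \<open>4 c a - c\<^sup>2 n\<close>\<close>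
  define c where "c = 2 * a / real n"
  have c: "0 \<le> c" using ab by (simp add: c_def)
  define S where "S t x = 2 * (a + b - 2 * t) + w t * real n * (x - t)" for t x :: real
  have [measurable]: "w \<in> borel_measurable borel"
    unfolding w_def[abs_def] by measurable
  have [measurable]: "L t \<in> borel_measurable borel" "S t \<in> borel_measurable borel" for t
    unfolding L_def[abs_def] S_def[abs_def] by measurable
  have [measurable]: "(\<lambda>x. L (fst x) (snd x 0)) \<in> borel_measurable (lborel \<Otimes>\<^sub>M ?P)"
      "(\<lambda>x. S (fst x) (snd x 0)) \<in> borel_measurable (lborel \<Otimes>\<^sub>M ?P)"
    unfolding L_def S_def by measurable
  have [measurable]: "(\<lambda>x. indicator {a..b} (fst x) :: ennreal) \<in> borel_measurable (lborel \<Otimes>\<^sub>M ?P)"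
    by (rule measurable_compose[OF measurable_fst]) simp
  have "W \<noteq> 0"
  proof
    assume "W = 0"
    then have "\<forall>t\<in>{a..b}. ((t - a) * (b - t))\<^sup>2 = 0"
      unfolding W_def using ab by (subst (asm) integral_eq_0_iff) (auto intro!: continuous_intros)
    from bspec[OF this, of "(a + b) / 2"] ab show False by simp
  qed
  moreover have "0 \<le> W"
    unfolding W_def by (rule integral_nonneg) (auto intro!: integrable_continuous_real continuous_intros)
  ultimately show W: "0 < W" by simp
  show V: "0 \<le> V" unfolding V_def by (rule integral_nonneg) (auto intro!: integrable_continuous_real continuous_intros)
  have EL: "(\<integral>\<^sup>+ y. ennreal (L t (y 0)) \<partial>?P) = 1" for t
    using nn_integral_lik[OF n, of "{0}" "?\<theta> t"] lik by simp
  have ER: "(\<integral>\<^sup>+ y. ennreal (L t (y 0) * (\<delta> y - t\<^sup>2)\<^sup>2) \<partial>?P) \<le> ennreal R" if "t \<in> {a..b}" for t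
    using risk_eq[OF n, of "{0}" "?\<theta> t" \<delta>] risk[of t] \<delta> lik Q that by simp
  \<comment> \<open>Weighting by \<open>L t\<close> turns this into an integral under mean
    \<open>t\<close>, where \<open>S t\<close> is affine in x - t with slope
    \<open>w t * real n\<close> and the noise has variance 1/n.\<close>
  have ES: "(\<integral>\<^sup>+ y. ennreal (L t (y 0) * (S t (y 0))\<^sup>2) \<partial>?P) = ennreal (4 * (a + b - 2 * t)\<^sup>2 + real n * (w t)\<^sup>2)" for t
  proof -
    have m: "(\<lambda>y. ennreal ((S t (y 0))\<^sup>2)) \<in> borel_measurable ?P" by measurable
    have "(\<integral>\<^sup>+ y. ennreal ((S t (y 0))\<^sup>2) \<partial>gauss_seq_model n (?\<theta> t)) =
        (\<integral>\<^sup>+ y. ennreal (lik n {0} (?\<theta> t) y) * ennreal ((S t (y 0))\<^sup>2) \<partial>?P)"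
      by (subst gauss_seq_model_density[OF n, of "{0}" "?\<theta> t"]) (simp_all add: nn_integral_density m)
    then have "(\<integral>\<^sup>+ y. ennreal (L t (y 0) * (S t (y 0))\<^sup>2) \<partial>?P) = (\<integral>\<^sup>+ y. ennreal ((S t (y 0))\<^sup>2) \<partial>gauss_seq_model n (?\<theta> t))"
      by (simp add: lik ennreal_mult L_def)
    also have "\<dots> = (\<integral>\<^sup>+ x. ennreal ((S t x)\<^sup>2) \<partial>density lborel (normal_density t (1 / sqrt (real n))))"
      by (subst nn_integral_gauss_coordinate[OF n, of "\<lambda>x. ennreal ((S t x)\<^sup>2)"]) auto
    also have "\<dots> = ennreal ((2 * (a + b - 2 * t))\<^sup>2 + (w t * real n)\<^sup>2 * (1 / sqrt (real n))\<^sup>2)"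
      unfolding S_def using n by (intro nn_integral_normal_affine_square) simp
    also have "(2 * (a + b - 2 * t))\<^sup>2 + (w t * real n)\<^sup>2 * (1 / sqrt (real n))\<^sup>2 = 4 * (a + b - 2 * t)\<^sup>2 + real n * (w t)\<^sup>2"
      using n by (simp add: power_mult_distrib power_divide power2_eq_square algebra_simps)
    finally show ?thesis .
  qed
  have "ennreal (4 * c * a * W) = (\<integral>\<^sup>+ t. ennreal (4 * c * a * (w t)\<^sup>2) * indicator {a..b} t \<partial>lborel)"
    using c ab by (subst nn_integral_Icc_continuous) (auto simp: W_def w_def intro!: continuous_intros)
  \<comment> \<open>On the interval \<open>a \<le> t\<close>: the derivative of t^2 is replaced by
    its least value.\<close>
  also have "\<dots> \<le> (\<integral>\<^sup>+ t. ennreal (4 * c * t * (w t)\<^sup>2) * indicator {a..b} t \<partial>lborel)"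
    using c by (intro nn_integral_mono) (auto simp: indicator_def intro!: ennreal_leI mult_right_mono mult_left_mono)
  also have "\<dots> = (\<integral>\<^sup>+ t. (\<integral>\<^sup>+ y. ennreal (4 * c * t * (w t)\<^sup>2 * L t (y 0)) * indicator {a..b} t \<partial>?P) \<partial>lborel)"
  proof (intro nn_integral_cong)
    fix t :: real
    show "ennreal (4 * c * t * (w t)\<^sup>2) * indicator {a..b} t =
        (\<integral>\<^sup>+ y. ennreal (4 * c * t * (w t)\<^sup>2 * L t (y 0)) * indicator {a..b} t \<partial>?P)"
    proof (cases "t \<in> {a..b}")
      case True
      then have "0 \<le> 4 * c * t * (w t)\<^sup>2" using c ab by simp
      then have "(\<integral>\<^sup>+ y. ennreal (4 * c * t * (w t)\<^sup>2 * L t (y 0)) \<partial>?P) =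
          (\<integral>\<^sup>+ y. ennreal (4 * c * t * (w t)\<^sup>2) * ennreal (L t (y 0)) \<partial>?P)"
        by (intro nn_integral_cong) (simp add: ennreal_mult L_def)
      also have "\<dots> = ennreal (4 * c * t * (w t)\<^sup>2)"
        by (subst nn_integral_cmult) (auto simp: EL)
      finally show ?thesis using True by simp
    qed simp
  qed
  \<comment> \<open>The pointwise inequality integrates over \<open>t\<close> for fixed
    \<open>y\<close>, but risk and score are controlled by integrating over \<open>y\<close> for
    fixed \<open>t\<close>; hence the order is exchanged here and once more below.\<close>
  also have "\<dots> = (\<integral>\<^sup>+ y. (\<integral>\<^sup>+ t. ennreal (4 * c * t * (w t)\<^sup>2 * L t (y 0)) * indicator {a..b} t \<partial>lborel) \<partial>?P)"
    by (intro PP.Fubini'[symmetric]) measurable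
  also have "\<dots> \<le> (\<integral>\<^sup>+ y. (\<integral>\<^sup>+ t. ennreal ((w t)\<^sup>2 * (L t (y 0) * (\<delta> y - t\<^sup>2)\<^sup>2) +
        c\<^sup>2 * (L t (y 0) * (S t (y 0))\<^sup>2)) * indicator {a..b} t \<partial>lborel) \<partial>?P)"
    unfolding w_def L_def S_def using ab c
    by (intro nn_integral_mono van_trees_pointwise) simp_all
  also have "\<dots> = (\<integral>\<^sup>+ t. (\<integral>\<^sup>+ y. ennreal ((w t)\<^sup>2 * (L t (y 0) * (\<delta> y - t\<^sup>2)\<^sup>2) +
        c\<^sup>2 * (L t (y 0) * (S t (y 0))\<^sup>2)) * indicator {a..b} t \<partial>?P) \<partial>lborel)"
    by (intro PP.Fubini') measurable
  also have "\<dots> \<le> (\<integral>\<^sup>+ t. ennreal ((w t)\<^sup>2 * R + c\<^sup>2 * (4 * (a + b - 2 * t)\<^sup>2 + real n * (w t)\<^sup>2)) * indicator {a..b} t \<partial>lborel)"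
  proof (intro nn_integral_mono)
    fix t :: real
    show "(\<integral>\<^sup>+ y. ennreal ((w t)\<^sup>2 * (L t (y 0) * (\<delta> y - t\<^sup>2)\<^sup>2) +
        c\<^sup>2 * (L t (y 0) * (S t (y 0))\<^sup>2)) * indicator {a..b} t \<partial>?P)
      \<le> ennreal ((w t)\<^sup>2 * R + c\<^sup>2 * (4 * (a + b - 2 * t)\<^sup>2 + real n * (w t)\<^sup>2)) * indicator {a..b} t"
    proof (cases "t \<in> {a..b}")
      case True
      have "(\<integral>\<^sup>+ y. ennreal ((w t)\<^sup>2 * (L t (y 0) * (\<delta> y - t\<^sup>2)\<^sup>2) + c\<^sup>2 * (L t (y 0) * (S t (y 0))\<^sup>2)) \<partial>?P)
        = (\<integral>\<^sup>+ y. ennreal ((w t)\<^sup>2) * ennreal (L t (y 0) * (\<delta> y - t\<^sup>2)\<^sup>2) + ennreal (c\<^sup>2) * ennreal (L t (y 0) * (S t (y 0))\<^sup>2) \<partial>?P)"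
        by (intro nn_integral_cong) (simp add: ennreal_mult[symmetric] ennreal_plus[symmetric] L_def del: ennreal_plus)
      also have "\<dots> = ennreal ((w t)\<^sup>2) * (\<integral>\<^sup>+ y. ennreal (L t (y 0) * (\<delta> y - t\<^sup>2)\<^sup>2) \<partial>?P)
          + ennreal (c\<^sup>2) * (\<integral>\<^sup>+ y. ennreal (L t (y 0) * (S t (y 0))\<^sup>2) \<partial>?P)"
        by (simp add: nn_integral_add nn_integral_cmult)
      also have "\<dots> \<le> ennreal ((w t)\<^sup>2) * ennreal R + ennreal (c\<^sup>2) * ennreal (4 * (a + b - 2 * t)\<^sup>2 + real n * (w t)\<^sup>2)"
        using ER[OF True] by (intro add_mono mult_left_mono) (auto simp: ES)
      also have "\<dots> = ennreal ((w t)\<^sup>2 * R + c\<^sup>2 * (4 * (a + b - 2 * t)\<^sup>2 + real n * (w t)\<^sup>2))"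
        using R by (simp add: ennreal_mult[symmetric] ennreal_plus[symmetric] del: ennreal_plus)
      finally show ?thesis using True by simp
    qed simp
  qed
  also have "\<dots> = ennreal (integral {a..b} (\<lambda>t. (w t)\<^sup>2 * R + c\<^sup>2 * (4 * (a + b - 2 * t)\<^sup>2 + real n * (w t)\<^sup>2)))"
    using R by (intro nn_integral_Icc_continuous) (auto simp: w_def intro!: continuous_intros)
  also have "integral {a..b} (\<lambda>t. (w t)\<^sup>2 * R + c\<^sup>2 * (4 * (a + b - 2 * t)\<^sup>2 + real n * (w t)\<^sup>2)) = W * R + c\<^sup>2 * (4 * V + real n * W)"
  proof -
    have "((\<lambda>t. (w t)\<^sup>2) has_integral W) {a..b}" "((\<lambda>t. (a + b - 2 * t)\<^sup>2) has_integral V) {a..b}"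
      unfolding W_def V_def w_def
      by (intro integrable_integral integrable_continuous_real continuous_intros)+
    then have "((\<lambda>t. (w t)\<^sup>2 * R + c\<^sup>2 * (4 * (a + b - 2 * t)\<^sup>2 + real n * (w t)\<^sup>2)) has_integral W * R + c\<^sup>2 * (4 * V + real n * W)) {a..b}"
      by (intro has_integral_add has_integral_mult_right has_integral_mult_left)
    then show ?thesis by (rule integral_unique)
  qed
  finally have "4 * c * a * W \<le> W * R + c\<^sup>2 * (4 * V + real n * W)"
    using R V W by (subst (asm) ennreal_le_iff) auto
  then have "4 * c * a - c\<^sup>2 * (4 * V / W + real n) \<le> R"
    using W by (simp add: field_simps)
  moreover have "4 * c * a - c\<^sup>2 * (4 * V / W + real n) = 4 * a\<^sup>2 / real n * (1 - 4 * V / (W * real n))"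
    using n W by (simp add: c_def field_simps power2_eq_square)
  ultimately show "4 * a\<^sup>2 / real n * (1 - 4 * V / (W * real n)) \<le> R" by simp
qed

subsection \<open>Two-point bound against a mixture\<close>

text \<open>Minimising over \<open>d\<close> leaves \<open>D\<^sup>2 l / (1 + l)\<close>, which is bounded below by its tangent in \<open>1 + l\<close>;
  the result is linear in quantities whose expectations are known.\<close>

lemma two_point_quadratic:
  fixes d D l K :: real
  assumes "0 \<le> l" "0 \<le> K"
  shows "2 * D\<^sup>2 / (1 + K) * l \<le> d\<^sup>2 + l * (d - D)\<^sup>2 + (D / (1 + K))\<^sup>2 * (l + l\<^sup>2)"
proof -
  define c where "c = 1 / (1 + K)"
  \<comment> \<open>The last square vanishes at d = l D / (1 + l), which minimises the left-hand
    side over d.\<close>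
  have "(1 + l) * (d\<^sup>2 + l * (d - D)\<^sup>2) = D\<^sup>2 * l + (d * (1 + l) - l * D)\<^sup>2"
    by algebra
  then have "D\<^sup>2 * l \<le> (1 + l) * (d\<^sup>2 + l * (d - D)\<^sup>2)" by simp
  then have "D\<^sup>2 * l * (1 / (1 + l)) \<le> d\<^sup>2 + l * (d - D)\<^sup>2"
    using assms by (simp add: field_simps)
  \<comment> \<open>The left-hand side is the tangent of 1 / x at x = 1 + K, taken at x = 1 +
    l.\<close>
  moreover have "2 * c - c\<^sup>2 * (1 + l) \<le> 1 / (1 + l)"
  proof -
    have "0 \<le> (1 - c * (1 + l))\<^sup>2" by simp
    then show ?thesis using assms by (simp add: field_simps power2_eq_square)
  qed
  then have "D\<^sup>2 * l * (2 * c - c\<^sup>2 * (1 + l)) \<le> D\<^sup>2 * l * (1 / (1 + l))"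
    using assms by (intro mult_left_mono) auto
  ultimately have "D\<^sup>2 * l * (2 * c - c\<^sup>2 * (1 + l)) \<le> d\<^sup>2 + l * (d - D)\<^sup>2" by simp
  moreover have "2 * D\<^sup>2 / (1 + K) * l = 2 * c * D\<^sup>2 * l" "D / (1 + K) = D * c"
    by (simp_all add: c_def)
  ultimately show ?thesis by (simp only:) (simp add: power2_eq_square algebra_simps)
qed

text \<open>\<open>K\<close> bounds the second moment at 0 of the likelihood ratio
  \<open>\<Lambda>\<close> of the uniform mixture. Integrating \<open>two_point_quadratic\<close> at
  l = \<open>\<Lambda> y\<close>, which has mean 1, gives \<open>2 * c \<le> 2 * R + c\<close> with
  \<open>c = D\<^sup>2 / (1 + K)\<close>, since \<open>R\<close> bounds both the risk at 0 and the
  average risk under the mixture.\<close>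

lemma mixture_lower_bound:
  fixes \<theta> :: "'a \<Rightarrow> nat \<Rightarrow> real"
  assumes n: "n > 0" and I: "finite I" and F: "finite F" "F \<noteq> {}"
    and supp: "\<And>f i. f \<in> F \<Longrightarrow> i \<notin> I \<Longrightarrow> \<theta> f i = 0"
    and Q: "\<And>f. f \<in> F \<Longrightarrow> Qfun (\<theta> f) = D"
    and K: "(\<Sum>f\<in>F. \<Sum>g\<in>F. exp (real n * (\<Sum>i\<in>I. \<theta> f i * \<theta> g i))) \<le> K * (real (card F))\<^sup>2"
    and \<delta>: "\<delta> \<in> estimators" and R: "0 \<le> R"
    and r0: "risk n \<delta> (\<lambda>_. 0) \<le> ennreal R"
    and r1: "\<And>f. f \<in> F \<Longrightarrow> risk n \<delta> (\<theta> f) \<le> ennreal R"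
  shows "D\<^sup>2 / (2 * (1 + K)) \<le> R"
proof -
  let ?P = "gauss_seq_model n (\<lambda>_. 0)"
  define N where "N = real (card F)"
  have N: "N > 0" using F by (auto simp: N_def card_gt_0_iff)
  have K0: "0 \<le> K"
  proof -
    have "0 \<le> K * N\<^sup>2" unfolding N_def
      by (rule order_trans[OF _ K]) (intro sum_nonneg; simp)
    then show ?thesis using N by (simp add: zero_le_mult_iff)
  qed
  note \<delta>[unfolded estimators_def, measurable]
  define \<Lambda> where "\<Lambda> y = (\<Sum>f\<in>F. lik n I (\<theta> f) y / N)" for y
  have [measurable]: "\<Lambda> \<in> borel_measurable (PiM UNIV (\<lambda>_. borel))"
    unfolding \<Lambda>_def by measurable
  have lik0: "0 \<le> lik n I \<eta> y" for \<eta> y by (simp add: lik_def prod_nonneg)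
  have \<Lambda>0: "0 \<le> \<Lambda> y" for y unfolding \<Lambda>_def using N lik0 by (intro sum_nonneg) auto
  have nn: "(\<integral>\<^sup>+ y. ennreal (\<Lambda> y * h y) \<partial>?P) = (\<Sum>f\<in>F. ennreal (1/N) * (\<integral>\<^sup>+ y. ennreal (lik n I (\<theta> f) y * h y) \<partial>?P))"
    if [measurable]: "h \<in> borel_measurable (PiM UNIV (\<lambda>_. borel))" and h: "\<And>y. 0 \<le> h y" for h
  proof -
    have "(\<integral>\<^sup>+ y. ennreal (\<Lambda> y * h y) \<partial>?P) = (\<integral>\<^sup>+ y. (\<Sum>f\<in>F. ennreal (1/N) * ennreal (lik n I (\<theta> f) y * h y)) \<partial>?P)"
      using N h lik0 unfolding \<Lambda>_def sum_distrib_right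
      by (intro nn_integral_cong) (simp add: ennreal_mult[symmetric] sum_ennreal)
    also have "\<dots> = (\<Sum>f\<in>F. ennreal (1/N) * (\<integral>\<^sup>+ y. ennreal (lik n I (\<theta> f) y * h y) \<partial>?P))"
      by (subst nn_integral_sum) (auto simp: nn_integral_cmult)
    finally show ?thesis .
  qed
  have const: "(\<Sum>f\<in>F. ennreal (1/N) * ennreal c) = ennreal c" if "0 \<le> c" for c
  proof -
    have "(\<Sum>f\<in>F. ennreal (1/N) * ennreal c) = ennreal (\<Sum>f\<in>F. (1/N) * c)"
      using N that by (subst sum_ennreal[symmetric]) (auto simp: ennreal_mult[symmetric])
    also have "(\<Sum>f\<in>F. (1/N) * c) = c" using N by (simp add: N_def)
    finally show ?thesis .
  qed
  have E1: "(\<integral>\<^sup>+ y. ennreal (\<Lambda> y) \<partial>?P) = 1"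
    using nn[of "\<lambda>_. 1"] const[of 1] nn_integral_lik[OF n I supp] by simp
  have E2: "(\<integral>\<^sup>+ y. ennreal ((\<Lambda> y)\<^sup>2) \<partial>?P) \<le> ennreal K"
  proof -
    \<comment> \<open>By \<open>lik_mult\<close> every product in the double sum is a constant times
      the likelihood ratio of \<open>\<theta> f + \<theta> g\<close>, which integrates to 1.\<close>
    have "(\<Lambda> y)\<^sup>2 = (\<Sum>f\<in>F. \<Sum>g\<in>F. exp (real n * (\<Sum>i\<in>I. \<theta> f i * \<theta> g i)) / N\<^sup>2 * lik n I (\<lambda>i. \<theta> f i + \<theta> g i) y)" for y
      unfolding \<Lambda>_def power2_eq_square sum_product
      by (intro sum.cong refl) (simp add: lik_mult)
    then have "(\<integral>\<^sup>+ y. ennreal ((\<Lambda> y)\<^sup>2) \<partial>?P) = (\<integral>\<^sup>+ y. (\<Sum>f\<in>F. \<Sum>g\<in>F.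
        ennreal (exp (real n * (\<Sum>i\<in>I. \<theta> f i * \<theta> g i)) / N\<^sup>2) * ennreal (lik n I (\<lambda>i. \<theta> f i + \<theta> g i) y)) \<partial>?P)"
      using lik0 by (simp add: ennreal_mult[symmetric] sum_ennreal sum_nonneg)
    also have "\<dots> = (\<Sum>f\<in>F. \<Sum>g\<in>F. ennreal (exp (real n * (\<Sum>i\<in>I. \<theta> f i * \<theta> g i)) / N\<^sup>2) *
        (\<integral>\<^sup>+ y. ennreal (lik n I (\<lambda>i. \<theta> f i + \<theta> g i) y) \<partial>?P))"
      by (simp add: nn_integral_sum nn_integral_cmult)
    also have "\<dots> = (\<Sum>f\<in>F. \<Sum>g\<in>F. ennreal (exp (real n * (\<Sum>i\<in>I. \<theta> f i * \<theta> g i)) / N\<^sup>2))"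
      using supp by (intro sum.cong refl) (simp add: nn_integral_lik[OF n I])
    also have "\<dots> = ennreal ((\<Sum>f\<in>F. \<Sum>g\<in>F. exp (real n * (\<Sum>i\<in>I. \<theta> f i * \<theta> g i))) / N\<^sup>2)"
      by (simp add: sum_ennreal sum_nonneg sum_divide_distrib)
    also have "\<dots> \<le> ennreal K"
      using K N by (intro ennreal_leI) (simp add: N_def field_simps)
    finally show ?thesis .
  qed
  have E3: "(\<integral>\<^sup>+ y. ennreal ((\<delta> y)\<^sup>2) \<partial>?P) \<le> ennreal R"
    using r0 unfolding risk_def by (simp add: Qfun_def)
  have E4: "(\<integral>\<^sup>+ y. ennreal (\<Lambda> y * (\<delta> y - D)\<^sup>2) \<partial>?P) \<le> ennreal R"
  proof -
    have "(\<integral>\<^sup>+ y. ennreal (lik n I (\<theta> f) y * (\<delta> y - D)\<^sup>2) \<partial>?P) \<le> ennreal R" if "f \<in> F" for f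
      using risk_eq[OF n I supp[OF that] \<delta>] r1[OF that] Q[OF that] by simp
    then have "(\<integral>\<^sup>+ y. ennreal (\<Lambda> y * (\<delta> y - D)\<^sup>2) \<partial>?P) \<le> (\<Sum>f\<in>F. ennreal (1/N) * ennreal R)"
      by (subst nn) (auto intro!: sum_mono mult_left_mono simp del: sum_constant)
    then show ?thesis using const[OF R] by simp
  qed
  define c where "c = D\<^sup>2 / (1 + K)"
  have c0: "c \<ge> 0" using K0 by (simp add: c_def)
  let ?e = "(D / (1 + K))\<^sup>2"
  have "ennreal (2 * c) = ennreal (2 * c) * (\<integral>\<^sup>+ y. ennreal (\<Lambda> y) \<partial>?P)" by (simp add: E1)
  also have "\<dots> = (\<integral>\<^sup>+ y. ennreal (2 * c * \<Lambda> y) \<partial>?P)"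
    using c0 \<Lambda>0 by (subst nn_integral_cmult[symmetric]) (auto simp: ennreal_mult)
  also have "\<dots> \<le> (\<integral>\<^sup>+ y. ennreal ((\<delta> y)\<^sup>2) + ennreal (\<Lambda> y * (\<delta> y - D)\<^sup>2)
      + ennreal ?e * (ennreal (\<Lambda> y) + ennreal ((\<Lambda> y)\<^sup>2)) \<partial>?P)"
  proof (intro nn_integral_mono)
    fix y
    have "ennreal (2 * c * \<Lambda> y) \<le> ennreal ((\<delta> y)\<^sup>2 + \<Lambda> y * (\<delta> y - D)\<^sup>2 + ?e * (\<Lambda> y + (\<Lambda> y)\<^sup>2))"
      using two_point_quadratic[OF \<Lambda>0[of y] K0, of D "\<delta> y"] by (intro ennreal_leI) (simp add: c_def)
    also have "\<dots> = ennreal ((\<delta> y)\<^sup>2) + ennreal (\<Lambda> y * (\<delta> y - D)\<^sup>2)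
      + ennreal ?e * (ennreal (\<Lambda> y) + ennreal ((\<Lambda> y)\<^sup>2))"
      using \<Lambda>0[of y] by (simp add: ennreal_plus ennreal_mult)
    finally show "ennreal (2 * c * \<Lambda> y) \<le> \<dots>" .
  qed
  also have "\<dots> = (\<integral>\<^sup>+ y. ennreal ((\<delta> y)\<^sup>2) \<partial>?P) + (\<integral>\<^sup>+ y. ennreal (\<Lambda> y * (\<delta> y - D)\<^sup>2) \<partial>?P)
      + ennreal ?e * ((\<integral>\<^sup>+ y. ennreal (\<Lambda> y) \<partial>?P) + (\<integral>\<^sup>+ y. ennreal ((\<Lambda> y)\<^sup>2) \<partial>?P))"
    by (simp add: nn_integral_add nn_integral_cmult)
  also have "\<dots> \<le> ennreal R + ennreal R + ennreal ?e * (1 + ennreal K)"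
    by (intro add_mono mult_left_mono E3 E4 E2) (simp_all add: E1)
  also have "\<dots> = ennreal (R + R + ?e * (1 + K))"
    using R K0 by (simp only: ennreal_1[symmetric] ennreal_plus[symmetric] ennreal_mult[symmetric]
        zero_le_power2 add_nonneg_nonneg zero_le_one mult_nonneg_nonneg)
  finally have "2 * c \<le> R + R + ?e * (1 + K)"
    using R K0 by (subst (asm) ennreal_le_iff) auto
  \<comment> \<open>With the tangent taken at 1 + K, the error term uses up exactly half of the main
    term \<open>2 * c\<close>.\<close>
  moreover have "?e * (1 + K) = c"
    using K0 by (simp add: c_def power_divide power2_eq_square)
  ultimately have "c / 2 \<le> R" by simp
  moreover have "c / 2 = D\<^sup>2 / (2 * (1 + K))" by (simp add: c_def)
  ultimately show ?thesis by simp
qed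

subsection \<open>Randomly placed spikes\<close>

text \<open>Block number and place in the block are quotient and remainder of \<open>i - l\<close>.
  The guard \<open>l \<le> i\<close> matters: truncated subtraction would send every
  \<open>i < l\<close> to the first place of the first block.\<close>

definition spikes :: "nat \<Rightarrow> nat \<Rightarrow> real \<Rightarrow> (nat \<Rightarrow> nat) \<Rightarrow> nat \<Rightarrow> real" where
  "spikes l k a f i = (if l \<le> i \<and> i < l + k * k \<and> f ((i - l) div k) = (i - l) mod k then a else 0)"

lemma sum_blocks:
  fixes h :: "nat \<Rightarrow> 'a :: comm_monoid_add"
  shows "(\<Sum>i\<in>{l..<l + k * k}. h i) = (\<Sum>b<k. \<Sum>j<k. h (l + (b * k + j)))"
proof -
  have "(\<Sum>i\<in>{l..<l + k * k}. h i) = (\<Sum>r<k * k. h (l + r))"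
    by (rule sum.reindex_bij_witness[of _ "\<lambda>r. l + r" "\<lambda>i. i - l"]) auto
  also have "\<dots> = (\<Sum>b<k. \<Sum>r\<in>{b * k..<b * k + k}. h (l + r))"
    by (rule sum.nat_group[symmetric])
  also have "\<dots> = (\<Sum>b<k. \<Sum>j<k. h (l + (b * k + j)))"
  proof (rule sum.cong[OF refl])
    fix b
    show "(\<Sum>r\<in>{b * k..<b * k + k}. h (l + r)) = (\<Sum>j<k. h (l + (b * k + j)))"
      by (rule sum.reindex_bij_witness[of _ "\<lambda>j. b * k + j" "\<lambda>r. r - b * k"]) auto
  qed
  finally show ?thesis .
qed

lemma spikes_block:
  "b < k \<Longrightarrow> j < k \<Longrightarrow> spikes l k a f (l + (b * k + j)) = (if f b = j then a else 0)"
proof -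
  assume "b < k" "j < k"
  then have "b * k + j < Suc b * k" "Suc b * k \<le> k * k" by (simp, intro mult_le_mono1) simp
  then have "b * k + j < k * k" by linarith
  with \<open>j < k\<close> show ?thesis by (simp add: spikes_def)
qed

lemma spikes_outside: "i \<notin> {l..<l + k * k} \<Longrightarrow> spikes l k a f i = 0"
  by (auto simp: spikes_def)

text \<open>A block contributes only at its spike, because \<open>h i 0 = 0\<close>. Suitable
  choices of \<open>h\<close> give the value of Q, the inner products and the weighted norm.\<close>

lemma sum_spikes:
  assumes "\<And>i. h i 0 = 0" "f \<in> {..<k} \<rightarrow>\<^sub>E {..<k}"
  shows "(\<Sum>i\<in>{l..<l + k * k}. h i (spikes l k a f i)) = (\<Sum>b<k. h (l + (b * k + f b)) a)"
proof -
  have "(\<Sum>j<k. h (l + (b * k + j)) (spikes l k a f (l + (b * k + j)))) = h (l + (b * k + f b)) a"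
    if b: "b < k" for b
  proof -
    have "f b < k" using PiE_mem[OF assms(2), of b] b by simp
    have "(\<Sum>j<k. h (l + (b * k + j)) (spikes l k a f (l + (b * k + j)))) =
        (\<Sum>j<k. if f b = j then h (l + (b * k + j)) a else 0)"
      using b assms(1) by (intro sum.cong refl) (simp add: spikes_block)
    then show ?thesis using \<open>f b < k\<close> by simp
  qed
  then show ?thesis unfolding sum_blocks by (intro sum.cong) auto
qed

lemma Qfun_spikes:
  assumes "f \<in> {..<k} \<rightarrow>\<^sub>E {..<k}"
  shows "Qfun (spikes l k a f) = real k * a\<^sup>2"
proof -
  have "Qfun (spikes l k a f) = (\<Sum>i\<in>{l..<l + k * k}. (spikes l k a f i)\<^sup>2)"
    by (intro Qfun_finite) (auto simp: spikes_outside)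
  also have "\<dots> = (\<Sum>b<k. a\<^sup>2)"
    by (rule sum_spikes[of "\<lambda>_ x. x\<^sup>2", OF _ assms]) simp
  also have "\<dots> = real k * a\<^sup>2" by simp
  finally show ?thesis .
qed

lemma sum_spikes_mult:
  assumes f: "f \<in> {..<k} \<rightarrow>\<^sub>E {..<k}"
  shows "(\<Sum>i\<in>{l..<l + k * k}. spikes l k a f i * spikes l k a g i) = (\<Sum>b<k. if g b = f b then a\<^sup>2 else 0)"
proof -
  have "(\<Sum>i\<in>{l..<l + k * k}. spikes l k a f i * spikes l k a g i) =
      (\<Sum>b<k. a * spikes l k a g (l + (b * k + f b)))"
    by (rule sum_spikes[of "\<lambda>i x. x * spikes l k a g i", OF _ f]) simp
  also have "\<dots> = (\<Sum>b<k. if g b = f b then a\<^sup>2 else 0)"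
  proof (rule sum.cong[OF refl])
    fix b assume b: "b \<in> {..<k}"
    with f have "f b < k" by (auto dest: PiE_mem)
    with b show "a * spikes l k a g (l + (b * k + f b)) = (if g b = f b then a\<^sup>2 else 0)"
      by (simp add: spikes_block power2_eq_square)
  qed
  finally show ?thesis .
qed

text \<open>The inner product is a^2 times the number of blocks where \<open>f\<close> and
  \<open>g\<close> agree. For fixed \<open>f\<close> the sum over \<open>g\<close> therefore factors
  over the blocks, each giving k - 1 + E, where E = exp(n a^2). Relative to k^k this is (1 + (E -
  1)/k)^k, at most exp(E - 1): as many places per block as blocks make the bound independent of
  k.\<close>

lemma spikes_second_moment:
  fixes n k :: nat and a :: real
  assumes k: "k > 0"
  defines "F \<equiv> {..<k} \<rightarrow>\<^sub>E {..<k}"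
  shows "(\<Sum>f\<in>F. \<Sum>g\<in>F. exp (real n * (\<Sum>i\<in>{l..<l + k * k}. spikes l k a f i * spikes l k a g i)))
    \<le> exp (exp (real n * a\<^sup>2) - 1) * (real (card F))\<^sup>2"
proof -
  define E where "E = exp (real n * a\<^sup>2)"
  have E: "1 \<le> E" by (simp add: E_def)
  have card: "real (card F) = real k ^ k" by (simp add: F_def card_PiE)
  have inner: "(\<Sum>g\<in>F. exp (real n * (\<Sum>i\<in>{l..<l + k * k}. spikes l k a f i * spikes l k a g i)))
      = (real k - 1 + E) ^ k" if f: "f \<in> F" for f
  proof -
    have "(\<Sum>g\<in>F. exp (real n * (\<Sum>i\<in>{l..<l + k * k}. spikes l k a f i * spikes l k a g i)))
        = (\<Sum>g\<in>F. \<Prod>b<k. if g b = f b then E else 1)"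
    proof (rule sum.cong[OF refl])
      fix g
      have "exp (real n * (\<Sum>i\<in>{l..<l + k * k}. spikes l k a f i * spikes l k a g i))
          = exp (\<Sum>b<k. real n * (if g b = f b then a\<^sup>2 else 0))"
        using f unfolding F_def by (simp only: sum_spikes_mult sum_distrib_left)
      also have "\<dots> = (\<Prod>b<k. if g b = f b then E else 1)"
        unfolding exp_sum[OF finite_lessThan] by (rule prod.cong[OF refl]) (simp add: E_def)
      finally show "exp (real n * (\<Sum>i\<in>{l..<l + k * k}. spikes l k a f i * spikes l k a g i))
          = (\<Prod>b<k. if g b = f b then E else 1)" .
    qed
    also have "\<dots> = (\<Prod>b<k. \<Sum>j<k. if j = f b then E else 1)"
      unfolding F_def by (rule prod_sum_PiE[symmetric]) auto
    also have "\<dots> = (\<Prod>b<k. real k - 1 + E)"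
    proof (intro prod.cong refl)
      fix b assume "b \<in> {..<k}"
      then have fb: "f b \<in> {..<k}" by (rule PiE_mem[OF f[unfolded F_def]])
      have "(\<Sum>j<k. if j = f b then E else 1) = (\<Sum>j<k. 1 + (if j = f b then E - 1 else 0))"
        by (intro sum.cong) auto
      also have "\<dots> = real k - 1 + E" using fb by (simp add: sum.distrib)
      finally show "(\<Sum>j<k. if j = f b then E else 1) = real k - 1 + E" .
    qed
    finally show ?thesis by simp
  qed
  have "(real k - 1 + E) ^ k \<le> (real k * exp ((E - 1) / real k)) ^ k"
  proof (rule power_mono)
    have "real k - 1 + E = real k * (1 + (E - 1) / real k)" using k by (simp add: field_simps)
    also have "\<dots> \<le> real k * exp ((E - 1) / real k)" by (intro mult_left_mono exp_ge_add_one_self) simp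
    finally show "real k - 1 + E \<le> real k * exp ((E - 1) / real k)" .
    show "0 \<le> real k - 1 + E" using k E by simp
  qed
  also have "\<dots> = real k ^ k * exp (E - 1)"
    unfolding power_mult_distrib exp_of_nat_mult[symmetric] using k by simp
  finally have "real k ^ k * (real k - 1 + E) ^ k \<le> real k ^ k * (real k ^ k * exp (E - 1))"
    by (intro mult_left_mono) auto
  moreover have "(\<Sum>f\<in>F. \<Sum>g\<in>F. exp (real n * (\<Sum>i\<in>{l..<l + k * k}. spikes l k a f i * spikes l k a g i)))
      = real k ^ k * (real k - 1 + E) ^ k"
    by (subst sum.cong[OF refl inner]) (simp_all add: card)
  moreover have "exp (E - 1) * (real (card F))\<^sup>2 = real k ^ k * (real k ^ k * exp (E - 1))"
    unfolding card power2_eq_square by (simp only: mult_ac)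
  ultimately show ?thesis unfolding E_def by (simp only:)
qed

lemma spikes_lower_bound:
  assumes n: "n > 0" and k: "k > 0" and \<delta>: "\<delta> \<in> estimators" and R: "0 \<le> R"
    and r0: "risk n \<delta> (\<lambda>_. 0) \<le> ennreal R"
    and r1: "\<And>f. f \<in> {..<k} \<rightarrow>\<^sub>E {..<k} \<Longrightarrow> risk n \<delta> (spikes l k a f) \<le> ennreal R"
  shows "(real k * a\<^sup>2)\<^sup>2 / (2 * (1 + exp (exp (real n * a\<^sup>2) - 1))) \<le> R"
proof (rule mixture_lower_bound[OF n _ _ _ _ _ _ \<delta> R r0 r1])
  show "({..<k} \<rightarrow>\<^sub>E {..<k}) \<noteq> {}" using k by (auto simp: PiE_eq_empty_iff)
  show "(\<Sum>f\<in>{..<k} \<rightarrow>\<^sub>E {..<k}. \<Sum>g\<in>{..<k} \<rightarrow>\<^sub>E {..<k}.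
      exp (real n * (\<Sum>i\<in>{l..<l + k * k}. spikes l k a f i * spikes l k a g i)))
    \<le> exp (exp (real n * a\<^sup>2) - 1) * (real (card ({..<k} \<rightarrow>\<^sub>E {..<k})))\<^sup>2"
    by (rule spikes_second_moment[OF k])
qed (auto simp: Qfun_spikes spikes_outside intro!: finite_PiE)

text \<open>For k = 2^h, the k^2 = 4^h coordinates from 4^h - 1 on form exactly wavelet level 2 h;
  the shift by 1 is due to coordinates starting at 0. The condition \<open>le\<close> gives each of
  the 2^h spikes the weight of index 2 * 4^h, an upper bound on the level.\<close>

lemma spikes_mem_balls:
  fixes a M p q \<alpha> :: real and h :: nat
  assumes pq: "0 < p" "0 < q" "0 < M" and s: "smooth_idx \<alpha> p \<ge> 0" and a: "0 \<le> a"
    and f: "f \<in> {..<2 ^ h} \<rightarrow>\<^sub>E {..<2 ^ h}"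
    and le: "(2 * 4 ^ h) powr (p * smooth_idx \<alpha> p) * 2 ^ h * a powr p \<le> M powr p"
  defines "\<theta> \<equiv> spikes (4 ^ h - 1) (2 ^ h) a f"
  shows "\<theta> \<in> Besov_ball \<alpha> p q M" "\<theta> \<in> Lp_ball \<alpha> p M"
proof -
  let ?l = "4 ^ h - 1 :: nat" and ?k = "2 ^ h :: nat" and ?t = "p * smooth_idx \<alpha> p"
  have kk: "?k * ?k = 4 ^ h" by (simp add: power_mult_distrib[symmetric])
  have J: "(2::nat) ^ (2 * h) = 4 ^ h" by (simp add: power_mult)
  have pos: "(1::nat) \<le> 4 ^ h" by simp
  have "(\<Sum>k<2 ^ (2 * h). real (2 ^ (2 * h) + k) powr ?t * \<bar>\<theta> (2 ^ (2 * h) + k - 1)\<bar> powr p)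
      \<le> (\<Sum>k<4 ^ h. (2 * 4 ^ h) powr ?t * \<bar>\<theta> (?l + k)\<bar> powr p)"
    unfolding J
  proof (intro sum_mono mult_mono powr_mono2)
    fix k :: nat assume "k \<in> {..<4 ^ h}"
    then have "real k \<le> real (4 ^ h)" by (subst of_nat_le_iff) auto
    then show "real (4 ^ h + k) \<le> 2 * 4 ^ h" by simp
  qed (use pq s pos in auto)
  also have "\<dots> = (\<Sum>i\<in>{?l..<?l + ?k * ?k}. (2 * 4 ^ h) powr ?t * \<bar>\<theta> i\<bar> powr p)"
    unfolding kk by (rule sum.reindex_bij_witness[of _ "\<lambda>i. i - ?l" "\<lambda>k. ?l + k"]) auto
  also have "\<dots> = (\<Sum>b<?k. (2 * 4 ^ h) powr ?t * \<bar>a\<bar> powr p)"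
    unfolding \<theta>_def by (rule sum_spikes[OF _ f]) (use pq in simp)
  also have "\<dots> \<le> M powr p" using le a by (simp add: mult_ac)
  finally have *: "(\<Sum>k<2 ^ (2 * h). real (2 ^ (2 * h) + k) powr ?t * \<bar>\<theta> (2 ^ (2 * h) + k - 1)\<bar> powr p) \<le> M powr p" .
  have out: "\<theta> i = 0" if "i + 1 < 2 ^ (2 * h) \<or> 2 ^ (2 * h + 1) \<le> i + 1" for i
  proof -
    have "(2::nat) ^ (2 * h + 1) = 4 ^ h + 4 ^ h" by (simp add: power_mult)
    then have "i \<notin> {?l..<?l + ?k * ?k}" using that pos unfolding J kk by auto
    then show ?thesis unfolding \<theta>_def by (rule spikes_outside)
  qed
  show "\<theta> \<in> Besov_ball \<alpha> p q M" "\<theta> \<in> Lp_ball \<alpha> p M"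
    using single_level_mem_balls[OF pq out s *] by auto
qed

subsection \<open>The minimax bounds\<close>

lemma minimax_risk_first_coordinate:
  fixes M \<epsilon> :: real
  assumes M: "0 < M" and \<epsilon>: "0 < \<epsilon>"
    and mem: "\<And>t. 0 \<le> t \<Longrightarrow> t \<le> M \<Longrightarrow> (\<lambda>i. if i = 0 then t else 0) \<in> \<Theta>"
  shows "\<forall>\<^sub>F n in sequentially. minimax_risk n \<Theta> \<ge> ennreal (4 * M\<^sup>2 / real n * (1 - \<epsilon>))"
proof -
  \<comment> \<open>The cap at 1 keeps \<open>a\<close> positive and \<open>1 - \<eta> / 2\<close>
    nonnegative for large \<epsilon>.\<close>
  define \<eta> where "\<eta> = min \<epsilon> 1"
  have \<eta>: "0 < \<eta>" "\<eta> \<le> 1" "\<eta> \<le> \<epsilon>" using \<epsilon> by (auto simp: \<eta>_def)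
  \<comment> \<open>Passing from M^2 to a^2 keeps at least the factor \<open>1 - \<eta> / 2\<close>,
    and so does the information of the prior for large n; the product of the two is at least
    \<open>1 - \<eta>\<close>.\<close>
  define a where "a = M * (1 - \<eta> / 4)"
  have a: "0 < a" "a < M" using M \<eta> by (auto simp: a_def)
  define W where "W = integral {a..M} (\<lambda>t. ((t - a) * (M - t))\<^sup>2)"
  define V where "V = integral {a..M} (\<lambda>t. (a + M - 2 * t)\<^sup>2)"
  \<comment> \<open>From \<open>N\<close> on, the correction \<open>4 * V / (W * real n)\<close> is
    at most \<open>\<eta> / 2\<close>; \<open>V\<close> and \<open>W\<close> do not depend on
    n.\<close>
  obtain N :: nat where N: "8 * V / (W * \<eta>) \<le> real N" using real_arch_simple by blast
  show ?thesis
    unfolding eventually_sequentially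
  proof (intro exI allI impI)
    fix n assume n: "max N 1 \<le> n"
    show "ennreal (4 * M\<^sup>2 / real n * (1 - \<epsilon>)) \<le> minimax_risk n \<Theta>"
    proof (rule minimax_lower_bound)
      fix \<delta> R assume \<delta>: "\<delta> \<in> estimators" and r: "\<And>\<theta>. \<theta> \<in> \<Theta> \<Longrightarrow> risk n \<delta> \<theta> \<le> ennreal R" and R: "0 \<le> (R::real)"
      have n0: "n > 0" using n by simp
      have risk: "risk n \<delta> (\<lambda>i. if i = 0 then t else 0) \<le> ennreal R" if "a \<le> t" "t \<le> M" for t
        using that a by (intro r mem) auto
      note vt = van_trees_square[OF n0 a \<delta> R risk, folded W_def V_def]
      have le: "4 * a\<^sup>2 / real n * (1 - 4 * V / (W * real n)) \<le> R" and W: "0 < W" and V: "0 \<le> V"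
        using vt by auto
      have "8 * V / (W * \<eta>) \<le> real n" using N n by linarith
      then have small: "4 * V / (W * real n) \<le> \<eta> / 2" using W \<eta> n0 by (simp add: field_simps)
      have a2: "M\<^sup>2 * (1 - \<eta> / 2) \<le> a\<^sup>2"
      proof -
        have "1 - \<eta> / 2 \<le> (1 - \<eta> / 4)\<^sup>2" by (simp add: power2_eq_square algebra_simps)
        then show ?thesis unfolding a_def power_mult_distrib by (intro mult_left_mono) auto
      qed
      have "(1 - \<eta> / 2) * (1 - \<eta> / 2) = 1 - \<eta> + \<eta> * \<eta> / 4" by (simp add: algebra_simps)
      moreover have "0 \<le> \<eta> * \<eta>" by simp
      ultimately have "1 - \<epsilon> \<le> (1 - \<eta> / 2) * (1 - \<eta> / 2)" using \<eta> by linarith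
      then have "M\<^sup>2 * (1 - \<epsilon>) \<le> M\<^sup>2 * (1 - \<eta> / 2) * (1 - \<eta> / 2)"
        unfolding mult.assoc by (intro mult_left_mono) auto
      also have "\<dots> \<le> a\<^sup>2 * (1 - 4 * V / (W * real n))"
        using a2 small \<eta> by (intro mult_mono) auto
      finally have "4 / real n * (M\<^sup>2 * (1 - \<epsilon>)) \<le> 4 / real n * (a\<^sup>2 * (1 - 4 * V / (W * real n)))"
        by (intro mult_left_mono) auto
      with le show "4 * M\<^sup>2 / real n * (1 - \<epsilon>) \<le> R" by simp
    qed
  qed
qed

lemma ex_power_4_between:
  fixes X :: real
  assumes "1 \<le> X"
  obtains h :: nat where "4 ^ h \<le> X" "X < 4 * 4 ^ h"
proof
  define h where "h = nat \<lfloor>log 4 X\<rfloor>"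
  have "0 \<le> log 4 X" using assms by simp
  then have h: "real h \<le> log 4 X" "log 4 X < real h + 1"
    unfolding h_def by linarith+
  have "4 powr real h \<le> 4 powr log 4 X" using h by (intro powr_mono) auto
  then show "4 ^ h \<le> X" using assms by (simp add: powr_realpow)
  have "4 powr log 4 X < 4 powr (real h + 1)" using h by (intro powr_less_mono) auto
  then show "X < 4 * 4 ^ h" using assms by (simp add: powr_realpow powr_add)
qed

text \<open>Both balls are treated at once by letting \<Theta> contain their intersection. The
  number 4^h of coordinates is the power of 4 within a factor 4 below n powr e.\<close>

lemma minimax_risk_spikes:
  fixes M p q \<alpha> :: real
  assumes pq: "0 < p" "0 < q" "0 < M" and s: "smooth_idx \<alpha> p > 0"
    and \<Theta>: "Besov_ball \<alpha> p q M \<inter> Lp_ball \<alpha> p M \<subseteq> \<Theta>"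
  shows "\<exists>C>0. \<forall>\<^sub>F n in sequentially. minimax_risk n \<Theta> \<ge>
    ennreal (C * real n powr (- (2 - p / (1 + 2 * p * smooth_idx \<alpha> p))))"
proof -
  let ?s = "smooth_idx \<alpha> p"
  \<comment> \<open>Chosen so that \<open>2 powr (p * ?s) * c powr p = M powr p\<close>; the power
    of 2 comes from the upper end of the level.\<close>
  define c where "c = M * 2 powr (- ?s)"
  have c: "0 < c" using pq by (simp add: c_def)
  \<comment> \<open>The spike height \<open>c / sqrt (real n)\<close> makes n a^2 = c^2, so the
    second moment bound does not depend on n.\<close>
  define K where "K = exp (exp (c\<^sup>2) - 1)"
  \<comment> \<open>The solution of \<open>e * (p * ?s + 1/2) = p / 2\<close>: the growth of
    \<open>X powr (p * ?s + 1/2)\<close> then cancels the decay n powr (- p/2) of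
    \<open>a powr p\<close>.\<close>
  define e where "e = p / (1 + 2 * p * ?s)"
  have e: "0 < e" using pq s by (simp add: e_def add_pos_pos)
  \<comment> \<open>The 8 is the 2 of the mixture bound times the 4 lost in
    \<open>X < 4 * 4 ^ h\<close>.\<close>
  define C where "C = c ^ 4 / (8 * (1 + K))"
  have K: "0 < K" by (simp add: K_def)
  have "minimax_risk n \<Theta> \<ge> ennreal (C * real n powr (- (2 - e)))" if n: "1 \<le> n" for n
  proof (rule minimax_lower_bound)
    fix \<delta> R assume \<delta>: "\<delta> \<in> estimators" and r: "\<And>\<theta>. \<theta> \<in> \<Theta> \<Longrightarrow> risk n \<delta> \<theta> \<le> ennreal R" and R: "0 \<le> (R::real)"
    define X where "X = real n powr e"
    have X: "1 \<le> X" using n e by (simp add: X_def ge_one_powr_ge_zero)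
    then obtain h where h: "4 ^ h \<le> X" "X < 4 * 4 ^ h" using ex_power_4_between by blast
    define a where "a = c / sqrt (real n)"
    have a: "0 \<le> a" using c by (simp add: a_def)
    have na: "real n * a\<^sup>2 = c\<^sup>2" using n by (simp add: a_def power_divide)
    have pow4: "(4::real) ^ h = (2 ^ h)\<^sup>2" by (simp add: power2_eq_square power_mult_distrib[symmetric])
    have "(2 * 4 ^ h) powr (p * ?s) * 2 ^ h * a powr p \<le> M powr p"
    proof -
      have "(2::real) ^ h = (4 ^ h) powr (1/2)"
        by (simp add: pow4 powr_half_sqrt)
      then have "(2 * 4 ^ h) powr (p * ?s) * 2 ^ h * a powr p = 2 powr (p * ?s) * (4 ^ h) powr (p * ?s + 1/2) * a powr p"
        by (simp add: powr_mult powr_add)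
      also have "\<dots> \<le> 2 powr (p * ?s) * X powr (p * ?s + 1/2) * a powr p"
        using h pq s by (intro mult_right_mono mult_left_mono powr_mono2) auto
      also have "\<dots> = M powr p"
      proof -
        have "1 + 2 * p * ?s > 0" using pq s by (simp add: add_pos_pos)
        then have "e * (p * ?s + 1/2) = p / 2" by (simp add: e_def field_simps)
        then have "X powr (p * ?s + 1/2) = real n powr (p / 2)"
          unfolding X_def powr_powr by (simp only:)
        moreover have "a powr p = c powr p * real n powr (- (p / 2))"
          using c n by (simp add: a_def powr_divide powr_half_sqrt[symmetric] powr_powr powr_minus field_simps)
        moreover have "c powr p = M powr p * 2 powr (- (p * ?s))"
          using pq by (simp add: c_def powr_mult powr_powr mult.commute)
        ultimately show ?thesis
          using n by (simp add: powr_minus field_simps)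
      qed
      finally show ?thesis .
    qed
    note mem = spikes_mem_balls[OF pq less_imp_le[OF s] a _ this]
    have "(real (2 ^ h) * a\<^sup>2)\<^sup>2 / (2 * (1 + exp (exp (real n * a\<^sup>2) - 1))) \<le> R"
    proof (rule spikes_lower_bound[OF _ _ \<delta> R])
      show "risk n \<delta> (\<lambda>_. 0) \<le> ennreal R"
        using \<Theta> zero_mem_balls[of p q M \<alpha>] pq s by (intro r) auto
      show "risk n \<delta> (spikes (4 ^ h - 1) (2 ^ h) a f) \<le> ennreal R" if "f \<in> {..<2 ^ h} \<rightarrow>\<^sub>E {..<2 ^ h}" for f
        using \<Theta> mem[OF that] by (intro r) auto
    qed (use n in auto)
    moreover have "(real (2 ^ h) * a\<^sup>2)\<^sup>2 = 4 ^ h * (a\<^sup>2)\<^sup>2"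
    proof -
      have "real (2 ^ h) = 2 ^ h" by simp
      then have "(real (2 ^ h))\<^sup>2 = 4 ^ h" by (simp only: pow4)
      then show ?thesis by (simp only: power_mult_distrib)
    qed
    ultimately have "4 ^ h * (a\<^sup>2)\<^sup>2 / (2 * (1 + K)) \<le> R"
      unfolding K_def na by (simp only:)
    moreover have "C * real n powr (- (2 - e)) \<le> 4 ^ h * (a\<^sup>2)\<^sup>2 / (2 * (1 + K))"
    proof -
      have "a\<^sup>2 = c\<^sup>2 / real n" using n na by (simp add: field_simps)
      then have a4: "(a\<^sup>2)\<^sup>2 = c ^ 4 / (real n)\<^sup>2" by (simp add: power_divide)
      have "real n powr (- (2 - e)) = X / (real n)\<^sup>2"
        using n by (simp add: X_def powr_diff)
      also have "\<dots> \<le> 4 * 4 ^ h / (real n)\<^sup>2" using h n by (intro divide_right_mono) auto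
      finally have "C * real n powr (- (2 - e)) \<le> C * (4 * 4 ^ h / (real n)\<^sup>2)"
        using K c by (intro mult_left_mono) (auto simp: C_def)
      also have "\<dots> = 4 ^ h * (a\<^sup>2)\<^sup>2 / (2 * (1 + K))"
        unfolding a4 C_def using K n by (simp add: divide_simps) (simp add: algebra_simps)?
      finally show ?thesis .
    qed
    ultimately show "C * real n powr (- (2 - e)) \<le> R" by linarith
  qed
  then have "\<forall>\<^sub>F n in sequentially. minimax_risk n \<Theta> \<ge> ennreal (C * real n powr (- (2 - e)))"
    unfolding eventually_sequentially by blast
  moreover have "C > 0" using c K by (simp add: C_def)
  ultimately show ?thesis unfolding e_def by blast
qed

text \<open>The lower bound with factor 1 + o(1) is expressed by a factor
  \<open>1 - \<epsilon>\<close>, for every positive \<epsilon> and all large n.\<close>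

theorem theorem4:
  fixes p q M \<alpha> :: real and \<Theta> :: "(nat \<Rightarrow> real) set"
  assumes "0 < p" "p < 2" "0 < q" "0 < M" "0 < \<alpha>"
    and "smooth_idx \<alpha> p > 0"
    and "\<Theta> = Besov_ball \<alpha> p q M \<or> \<Theta> = Lp_ball \<alpha> p M"
  shows "(\<alpha> > 1 / (2*p) \<longrightarrow>
            (\<forall>\<epsilon>>0. \<forall>\<^sub>F n in sequentially.
               minimax_risk n \<Theta> \<ge> ennreal (4 * M^2 / real n * (1 - \<epsilon>))))
       \<and> (\<alpha> \<le> 1 / (2*p) \<longrightarrow>
            (\<exists>C>0. \<forall>\<^sub>F n in sequentially.
               minimax_risk n \<Theta> \<ge>
                 ennreal (C * real n powr (- (2 - p / (1 + 2 * p * smooth_idx \<alpha> p))))))"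
proof (intro conjI impI allI)
  fix \<epsilon> :: real assume "0 < \<epsilon>"
  then show "\<forall>\<^sub>F n in sequentially. minimax_risk n \<Theta> \<ge> ennreal (4 * M^2 / real n * (1 - \<epsilon>))"
    using assms first_coordinate_mem_balls[of p q M \<alpha>]
    by (intro minimax_risk_first_coordinate) auto
next
  show "\<exists>C>0. \<forall>\<^sub>F n in sequentially. minimax_risk n \<Theta> \<ge>
      ennreal (C * real n powr (- (2 - p / (1 + 2 * p * smooth_idx \<alpha> p))))"
    using assms by (intro minimax_risk_spikes[where q = q and M = M]) auto
qed

end
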